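(* Let $n$ be an even integer, let $1\le k\le n/2-1$ be an integer, and let $f:\mathbb N\to\mathbb N$ satisfy $f(n)=\omega(\sqrt n)$. Let $G$ be a $(2k+1)$-regular graph on the vertex set $[n]$. Then with high probability $\tau_{\text{lab}}(G,n)\ge (k+1)n-f(n)$.
   Context: Semi-random no-replacement multigraph process on $[n]=\{1,\dots,n\}$: let $\pi_1,\pi_2,\dots$ be independent uniformly random permutations in $S_n$. Builder's multigraph starts empty on $[n]$. In round $k\ge1$ Builder is offered the vertex $v_k:=\pi_{\lceil k/n\rceil}(k-\lfloor (k-1)/n\rfloor n)$; Builder then chooses a vertex $u_k$ according to his strategy (a rule depending on the history so far) and adds the edge $u_kv_k$ (multiple edges allowed). For a labeled graph $G$ on $[n]$ and a strategy $\mathcal S$, $\tau(\mathcal S)$ is the least $m$ such that Builder's multigraph after $m$ rounds contains $G$ as a subgraph (with the same labels). $\tau_{\text{lab}}(G,n)$ is a random variable with $\Pr(\tau_{\text{lab}}(G,n)\le k)=\max_{\mathcal S}\Pr(\tau(\mathcal S)\le k)$ for all $k\ge0$. W.h.p. means with probability tending to $1$ as $n\to\infty$. *)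

theory Defs
  imports "HOL-Probability.Probability" "HOL-Combinatorics.Permutations"
    "HOL-Library.Landau_Symbols"
begin

definition regular_graph_on :: "nat set \<Rightarrow> nat \<Rightarrow> nat set set \<Rightarrow> bool" where
  "regular_graph_on V d E \<longleftrightarrow>
     (\<forall>e\<in>E. e \<subseteq> V \<and> card e = 2) \<and> (\<forall>v\<in>V. card {e \<in> E. v \<in> e} = d)"

definition perm_space :: "nat \<Rightarrow> (nat \<Rightarrow> nat \<Rightarrow> nat) measure" where
  "perm_space n = (\<Pi>\<^sub>M j\<in>{1..}. uniform_count_measure {p. p permutes {1..n}})"

definition offered :: "nat \<Rightarrow> (nat \<Rightarrow> nat \<Rightarrow> nat) \<Rightarrow> nat \<Rightarrow> nat" where
  "offered n \<pi> k = \<pi> (nat \<lceil>real k / real n\<rceil>) (k - (k - 1) div n * n)"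

text \<open>A strategy maps the history of past rounds, recorded as pairs (chosen vertex, offered
  vertex), and the currently offered vertex to the vertex Builder chooses.\<close>

type_synonym strategy = "(nat \<times> nat) list \<Rightarrow> nat \<Rightarrow> nat"

definition strategies :: "nat \<Rightarrow> strategy set" where
  "strategies n = {S. \<forall>h. \<forall>v\<in>{1..n}. S h v \<in> {1..n}}"

primrec history :: "strategy \<Rightarrow> (nat \<Rightarrow> nat) \<Rightarrow> nat \<Rightarrow> (nat \<times> nat) list" where
  "history S v 0 = []"
| "history S v (Suc m) = history S v m @ [(S (history S v m) (v (Suc m)), v (Suc m))]"

text \<open>A loop at \<open>v\<close>, arising when Builder chooses the offered vertex, is the edge \<open>{v}\<close>;
  it never is an edge of a simple graph.\<close>

definition builder_multigraph :: "strategy \<Rightarrow> (nat \<Rightarrow> nat) \<Rightarrow> nat \<Rightarrow> nat set multiset" where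
  "builder_multigraph S v m = mset (map (\<lambda>(u, w). {u, w}) (history S v m))"

definition tau :: "nat set set \<Rightarrow> nat \<Rightarrow> strategy \<Rightarrow> (nat \<Rightarrow> nat \<Rightarrow> nat) \<Rightarrow> enat" where
  "tau E n S \<pi> = Inf (enat ` {m. E \<subseteq> set_mset (builder_multigraph S (offered n \<pi>) m)})"

definition success_prob :: "nat set set \<Rightarrow> nat \<Rightarrow> nat \<Rightarrow> strategy \<Rightarrow> real" where
  "success_prob E n k S = measure (perm_space n) {\<pi> \<in> space (perm_space n). tau E n S \<pi> \<le> enat k}"

text \<open>The labelled hitting time is only specified through its distribution, so it is a property
  of a random variable \<open>T\<close> on an arbitrary probability space \<open>M\<close>. The maximum below is over a
  finite nonempty set of values, and such a \<open>T\<close> always exists: see \<open>finite_success_probs\<close> and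
  \<open>tau_lab_exists\<close>.\<close>

definition is_tau_lab :: "nat set set \<Rightarrow> nat \<Rightarrow> 'a measure \<Rightarrow> ('a \<Rightarrow> enat) \<Rightarrow> bool" where
  "is_tau_lab E n M T \<longleftrightarrow>
     prob_space M \<and> T \<in> M \<rightarrow>\<^sub>M count_space UNIV \<and>
     (\<forall>k. measure M {x \<in> space M. T x \<le> enat k} = Max (success_prob E n k ` strategies n))"

lemma strategies_nonempty: "n \<ge> 1 \<Longrightarrow> strategies n \<noteq> {}"
proof -
  assume "n \<ge> 1"
  then have "(\<lambda>h v. v) \<in> strategies n" by (auto simp: strategies_def)
  then show ?thesis by blast
qed

lemma tau_le_iff:
  "tau E n S \<pi> \<le> enat k \<longleftrightarrow> (\<exists>m\<le>k. E \<subseteq> set_mset (builder_multigraph S (offered n \<pi>) m))"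
  (is "?l \<longleftrightarrow> ?r")
proof
  let ?A = "{m. E \<subseteq> set_mset (builder_multigraph S (offered n \<pi>) m)}"
  assume l: ?l
  then have "enat ` ?A \<noteq> {}" unfolding tau_def by (auto simp: Inf_enat_def split: if_splits)
  then have "tau E n S \<pi> \<in> enat ` ?A"
    unfolding tau_def by (metis wellorder_InfI ex_in_conv)
  with l show ?r by auto
next
  assume ?r
  then show ?l unfolding tau_def by (meson Inf_lower2 enat_ord_simps(1) imageI mem_Collect_eq)
qed

lemma history_cong: "(\<And>i. i \<in> {1..m} \<Longrightarrow> v i = w i) \<Longrightarrow> history S v m = history S w m"
  by (induction m) auto

lemma offered_in:
  assumes n: "n \<ge> 1" and k: "k \<ge> 1" and p: "\<pi> \<in> space (perm_space n)"
  shows "offered n \<pi> k \<in> {1..n}"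
proof -
  have "real k / real n > 0" using n k by simp
  then have "nat \<lceil>real k / real n\<rceil> \<ge> 1" by linarith
  then have perm: "\<pi> (nat \<lceil>real k / real n\<rceil>) permutes {1..n}"
    using p by (auto simp: perm_space_def space_PiM space_uniform_count_measure PiE_def Pi_def)
  have "k - (k - 1) div n * n = (k - 1) mod n + 1"
    using k by (metis Nat.add_diff_assoc2 add.commute div_times_less_eq_dividend
      le_add_diff_inverse2 minus_div_mult_eq_mod)
  moreover have "(k - 1) mod n < n" using n by simp
  ultimately have "k - (k - 1) div n * n \<in> {1..n}" by auto
  then show ?thesis unfolding offered_def using permutes_in_image[OF perm] by blast
qed

lemma finite_success_probs:
  assumes "n \<ge> 1"
  shows "finite (success_prob E n k ` strategies n)"
proof -
  define L where "L = ({1..k} \<rightarrow>\<^sub>E {1..n})"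
  define ev where "ev A = {\<pi> \<in> space (perm_space n). restrict (offered n \<pi>) {1..k} \<in> A}" for A
  have "\<exists>A \<in> Pow L. success_prob E n k S = measure (perm_space n) (ev A)" for S
  proof
    let ?A = "{v \<in> L. \<exists>m\<le>k. E \<subseteq> set_mset (builder_multigraph S v m)}"
    show "?A \<in> Pow L" by auto
    have h: "history S (restrict (offered n \<pi>) {1..k}) m = history S (offered n \<pi>) m"
      if "m \<le> k" for \<pi> m
      using that by (intro history_cong) auto
    have "{\<pi> \<in> space (perm_space n). tau E n S \<pi> \<le> enat k} = ev ?A"
      using offered_in[OF assms] h
      by (auto simp: ev_def L_def tau_le_iff builder_multigraph_def cong: conj_cong)
    then show "success_prob E n k S = measure (perm_space n) (ev ?A)"
      by (simp add: success_prob_def)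
  qed
  then have "success_prob E n k ` strategies n \<subseteq> (\<lambda>A. measure (perm_space n) (ev A)) ` Pow L"
    by blast
  moreover have "finite L" unfolding L_def by (intro finite_PiE) auto
  ultimately show ?thesis by (meson finite_Pow_iff finite_imageI finite_subset)
qed

lemma prob_space_perm_space: "prob_space (perm_space n)"
  unfolding perm_space_def
proof (rule prob_space_PiM)
  have "{p. p permutes {1..n}} \<noteq> {}" using permutes_id by blast
  then show "prob_space (uniform_count_measure {p. p permutes {1..n}})"
    by (intro prob_space_uniform_count_measure finite_permutations) auto
qed

lemma offered_measurable [measurable]:
  assumes "n \<ge> 1" "k \<ge> 1"
  shows "(\<lambda>\<pi>. offered n \<pi> k) \<in> perm_space n \<rightarrow>\<^sub>M count_space UNIV"
proof -
  have "real k / real n > 0" using assms by simp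
  then have j: "nat \<lceil>real k / real n\<rceil> \<in> {1..}" by simp linarith
  have "(\<lambda>\<pi>. \<pi> (nat \<lceil>real k / real n\<rceil>)) \<in>
      perm_space n \<rightarrow>\<^sub>M uniform_count_measure {p. p permutes {1..n}}"
    unfolding perm_space_def by (rule measurable_component_singleton[OF j])
  moreover have "(\<lambda>p. p (k - (k - 1) div n * n)) \<in>
      uniform_count_measure {p. p permutes {1..n}} \<rightarrow>\<^sub>M count_space UNIV"
    by (auto simp: measurable_def space_uniform_count_measure sets_uniform_count_measure)
  ultimately show ?thesis unfolding offered_def by (rule measurable_compose)
qed

lemma history_measurable:
  assumes "n \<ge> 1"
  shows "(\<lambda>\<pi>. history S (offered n \<pi>) m) \<in> perm_space n \<rightarrow>\<^sub>M count_space UNIV"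
proof (induction m)
  case (Suc m)
  have o: "(\<lambda>\<pi>. offered n \<pi> (Suc m)) \<in> perm_space n \<rightarrow>\<^sub>M count_space UNIV"
    using assms by measurable
  have "(\<lambda>\<pi>. (history S (offered n \<pi>) m, offered n \<pi> (Suc m))) \<in>
      perm_space n \<rightarrow>\<^sub>M count_space UNIV"
    using measurable_Pair[OF Suc o] by (simp add: pair_measure_countable)
  from measurable_compose[OF this, of "\<lambda>(h, v). h @ [(S h v, v)]" "count_space UNIV"]
  show ?case by simp
qed simp

lemma success_event_measurable:
  assumes "n \<ge> 1"
  shows "{\<pi> \<in> space (perm_space n). tau E n S \<pi> \<le> enat k} \<in> sets (perm_space n)"
proof -
  have "{\<pi> \<in> space (perm_space n). E \<subseteq> set_mset (builder_multigraph S (offered n \<pi>) m)}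
      \<in> sets (perm_space n)" for m
    using measurable_sets[OF history_measurable[OF assms, of S m],
      of "{h. E \<subseteq> set_mset (mset (map (\<lambda>(u, w). {u, w}) h))}"]
    by (simp add: builder_multigraph_def vimage_def Int_def conj_commute)
  then have "(\<Union>m\<in>{..k}. {\<pi> \<in> space (perm_space n).
      E \<subseteq> set_mset (builder_multigraph S (offered n \<pi>) m)}) \<in> sets (perm_space n)"
    by blast
  also have "(\<Union>m\<in>{..k}. {\<pi> \<in> space (perm_space n).
      E \<subseteq> set_mset (builder_multigraph S (offered n \<pi>) m)}) =
      {\<pi> \<in> space (perm_space n). tau E n S \<pi> \<le> enat k}"
    by (auto simp: tau_le_iff)
  finally show ?thesis .
qed

lemma tau_lab_exists:
  assumes n: "n \<ge> 1"
  shows "\<exists>(M :: real measure) T. is_tau_lab E n M T"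
proof -
  interpret P: prob_space "perm_space n" by (rule prob_space_perm_space)
  define F where "F k = Max (success_prob E n k ` strategies n)" for k
  note fin = finite_success_probs[OF n, of E]
  note ne = strategies_nonempty[OF n]
  have F_ex: "\<exists>S\<in>strategies n. F k = success_prob E n k S" for k
    using Max_in[OF fin[of k]] ne unfolding F_def by blast
  have F01: "0 \<le> F k" "F k \<le> 1" for k
    using F_ex[of k] by (auto simp: success_prob_def)
  have F_mono: "F k \<le> F l" if "k \<le> l" for k l
  proof -
    obtain S where S: "S \<in> strategies n" "F k = success_prob E n k S" using F_ex by blast
    have "success_prob E n k S \<le> success_prob E n l S"
      unfolding success_prob_def
      by (intro P.finite_measure_mono success_event_measurable n)
        (auto intro: order_trans simp: that)
    also have "\<dots> \<le> F l" unfolding F_def using S fin by (intro Max_ge) auto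
    finally show ?thesis using S by simp
  qed
  define M where "M = uniform_measure lborel {0..1::real}"
  define T where "T x = Inf (enat ` {k. x \<le> F k})" for x
  have T_le: "T x \<le> enat k \<longleftrightarrow> x \<le> F k" for x k
  proof
    assume l: "T x \<le> enat k"
    then have "enat ` {k. x \<le> F k} \<noteq> {}" unfolding T_def by (auto simp: Inf_enat_def split: if_splits)
    then have "T x \<in> enat ` {k. x \<le> F k}" unfolding T_def by (metis wellorder_InfI ex_in_conv)
    with l show "x \<le> F k" using F_mono order_trans by fastforce
  qed (auto simp: T_def intro: Inf_lower)
  have "prob_space M" unfolding M_def by (intro prob_space_uniform_measure) auto
  moreover have "T \<in> M \<rightarrow>\<^sub>M count_space UNIV"
  proof -
    have le: "T -` {..enat k} \<in> sets borel" for k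
    proof -
      have "T -` {..enat k} = {..F k}" by (auto simp: T_le)
      then show ?thesis by simp
    qed
    have "T -` {a} \<in> sets borel" for a
    proof (cases a)
      case (enat k)
      have "T -` {a} = T -` {..enat k} - (\<Union>j\<in>{..<k}. T -` {..enat j})"
      proof (intro equalityI subsetI)
        fix x assume x: "x \<in> T -` {..enat k} - (\<Union>j\<in>{..<k}. T -` {..enat j})"
        then obtain t where t: "T x = enat t" by (cases "T x") auto
        have "t = k"
        proof (rule ccontr)
          assume "t \<noteq> k"
          then have "t < k" using x t by auto
          then show False using x t by auto
        qed
        then show "x \<in> T -` {a}" using t enat by simp
      qed (use enat in auto)
      moreover have "\<dots> \<in> sets borel" using le by blast
      ultimately show ?thesis by simp
    next
      case infinity
      have "T -` {a} = UNIV - (\<Union>j. T -` {..enat j})"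
        using infinity by (auto simp: not_le) (metis enat_ord_code(4) less_irrefl not_infinity_eq order_refl)
      moreover have "\<dots> \<in> sets borel"
        using le by (intro sets.Diff sets.countable_UN) auto
      ultimately show ?thesis by simp
    qed
    then have "T \<in> borel \<rightarrow>\<^sub>M count_space UNIV"
      by (subst measurable_count_space_eq_countable) auto
    moreover have "sets M = sets borel" by (simp add: M_def)
    ultimately show ?thesis using measurable_cong_sets by blast
  qed
  moreover have "measure M {x \<in> space M. T x \<le> enat k} = F k" for k
  proof -
    have "{0..1} \<inter> {..F k} = {0..F k}" using F01 by auto
    then show ?thesis
      using F01[of k] by (simp add: M_def T_le measure_uniform_measure flip: atMost_def)
  qed
  ultimately show ?thesis unfolding is_tau_lab_def F_def by blast
qed

end

theory Submission
  imports Defs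
begin

text \<open>After the first \<open>k n\<close> rounds a set \<open>R\<close> of at least \<open>n / 2\<close> edges of \<open>G\<close> is still missing, and
  it is independent of the last permutation. If Builder finishes before the last \<open>g\<close> rounds of
  that permutation, then assigning to each edge of \<open>R\<close> the offered vertex of a round in which it
  was built is an injective choice of endpoints that avoids the random set \<open>A\<close> of the \<open>g\<close>
  vertices not yet offered. Hence \<open>A\<close> contains neither an edge of \<open>R\<close> nor two vertices with a
  common neighbour in \<open>R\<close>. There are \<open>n / 8\<close> pairwise disjoint such pairs, so by the second
  moment method this has probability \<open>O(n / g\<^sup>2)\<close>.\<close>

section \<open>Images of a fixed set under a uniform permutation\<close>

lemma ex_permutes_image_eq:
  assumes "finite V" "B \<subseteq> V" "C \<subseteq> V" "card B = card C"
  shows "\<exists>s. s permutes V \<and> s ` B = C"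
proof -
  have fin: "finite B" "finite C" using assms finite_subset by blast+
  obtain a where a: "bij_betw a B C"
    using finite_same_card_bij[OF fin assms(4)] by blast
  have "card (V - B) = card (V - C)" using assms fin by (simp add: card_Diff_subset)
  then obtain b where b: "bij_betw b (V - B) (V - C)"
    using finite_same_card_bij[of "V - B" "V - C"] assms(1) by blast
  define s where "s x = (if x \<in> B then a x else if x \<in> V then b x else x)" for x
  have sB: "bij_betw s B C" using a by (auto simp: s_def cong: bij_betw_cong)
  have "bij_betw s (V - B) (V - C)"
    using b by (rule iffD1[OF bij_betw_cong, rotated]) (auto simp: s_def)
  with sB have "bij_betw s (B \<union> (V - B)) (C \<union> (V - C))"
    by (rule bij_betw_combine) auto
  then have "bij_betw s V V" using assms by (simp add: Un_absorb1)
  then have "s permutes V"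
    by (rule bij_imp_permutes) (use assms in \<open>auto simp: s_def\<close>)
  then show ?thesis using sB by (auto simp: bij_betw_def)
qed

text \<open>Double counting of the pairs (\<open>p\<close>, \<open>C\<close>) where \<open>C\<close>
  has the size of \<open>B\<close> and lies in the image of \<open>L\<close>: composing with a
  permutation that carries \<open>B\<close> to \<open>C\<close> shows that the number of
  \<open>p\<close> is the same for each \<open>C\<close>. In probabilistic terms, the image of
  \<open>L\<close> is a uniform subset of its size; the product form avoids division.\<close>

lemma card_permutes_superset:
  assumes V: "finite V" "L \<subseteq> V" "B \<subseteq> V"
  shows "card {p. p permutes V \<and> B \<subseteq> p ` L} * (card V choose card B)
    = fact (card V) * (card L choose card B)"
proof -
  let ?P = "{p. p permutes V}"
  let ?S = "{C. C \<subseteq> V \<and> card C = card B}"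
  let ?N = "\<lambda>C. {p. p permutes V \<and> C \<subseteq> p ` L}"
  have finP: "finite ?P" by (rule finite_permutations) fact
  have "card (?N C) = card (?N B)" if C: "C \<in> ?S" for C
  proof -
    obtain s where s: "s permutes V" "s ` B = C"
      using ex_permutes_image_eq[of V B C] V C by auto
    have "bij_betw (\<lambda>p. s \<circ> p) (?N B) (?N C)"
    proof (rule bij_betwI[where g = "\<lambda>p. inv s \<circ> p"])
      show "(\<lambda>p. s \<circ> p) \<in> ?N B \<rightarrow> ?N C"
        using s by (auto simp: permutes_compose image_comp[symmetric] simp del: image_comp)
      have "inv s ` C = B" using s by (metis inv_f_f image_inv_f_f permutes_inj)
      then show "(\<lambda>p. inv s \<circ> p) \<in> ?N C \<rightarrow> ?N B"
        using s(1) by (auto simp: permutes_compose permutes_inv image_comp[symmetric] simp del: image_comp)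
    qed (use permutes_inv_o[OF s(1)] in \<open>auto simp: o_assoc\<close>)
    then show ?thesis by (simp add: bij_betw_same_card)
  qed
  then have "(\<Sum>C\<in>?S. card (?N C)) = (card V choose card B) * card (?N B)"
    by (simp add: n_subsets[OF V(1)])
  moreover have "(\<Sum>C\<in>?S. card (?N C)) = (\<Sum>p\<in>?P. card {C \<in> ?S. C \<subseteq> p ` L})"
  proof -
    have "?N C = {p \<in> ?P. C \<subseteq> p ` L}" for C by auto
    moreover have "finite ?S" using V(1) by simp
    ultimately show ?thesis
      using sum_multicount_gen[of ?S ?P "\<lambda>C p. C \<subseteq> p ` L" "\<lambda>p. card {C \<in> ?S. C \<subseteq> p ` L}"] finP
      by simp
  qed
  moreover have "card {C \<in> ?S. C \<subseteq> p ` L} = card L choose card B" if "p \<in> ?P" for p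
  proof -
    have p: "p permutes V" using that by simp
    then have sub: "p ` L \<subseteq> V" using V(2) permutes_image by blast
    then have "{C \<in> ?S. C \<subseteq> p ` L} = {C. C \<subseteq> p ` L \<and> card C = card B}" by auto
    moreover have "card (p ` L) = card L"
      using permutes_inj_on[OF p] by (rule card_image)
    ultimately show ?thesis
      using n_subsets[of "p ` L" "card B"] finite_subset[OF sub V(1)] by simp
  qed
  ultimately show ?thesis by (simp add: card_permutations[OF refl V(1)] mult.commute)
qed

text \<open>Chebyshev's inequality for the number of pairs inside the random set \<open>p ` L\<close>; containment
  of disjoint pairs is negatively correlated, so the variance is at most the mean.\<close>

lemma card_permutes_avoiding_pairs:
  assumes V: "finite V" "L \<subseteq> V" "card V \<ge> 4" "card L \<ge> 2"
    and Q: "disjoint Q" "\<And>q. q \<in> Q \<Longrightarrow> q \<subseteq> V \<and> card q = 2"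
  shows "real (card {p. p permutes V \<and> (\<forall>q\<in>Q. \<not> q \<subseteq> p ` L)})
      * (real (card Q) * real (card L choose 2))
    \<le> fact (card V) * real (card V choose 2)"
proof -
  define n where "n = card V"
  define l where "l = card L"
  define P where "P = {p. p permutes V}"
  define N where "N B = real (card {p \<in> P. B \<subseteq> p ` L})" for B
  \<comment> \<open>For uniform \<open>p\<close>, \<open>X p\<close> counts the pairs of
    \<open>Q\<close> inside the image of \<open>L\<close>. Each pair is inside with probability
    \<open>r\<close>, so the mean is \<open>m * r\<close>. Expectations are kept as sums over
    \<open>P\<close>, which carry a factor \<open>fact n\<close>.\<close>
  define X where "X p = (\<Sum>q\<in>Q. if q \<subseteq> p ` L then 1 else 0 :: real)" for p
  define r where "r = real (l choose 2) / real (n choose 2)"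
  define m where "m = real (card Q)"
  have finP: "finite P" unfolding P_def by (rule finite_permutations) fact
  have cP: "real (card P) = fact n"
    unfolding P_def n_def by (simp add: card_permutations[OF refl V(1)])
  have finQ: "finite Q"
    using Q(2) V(1) by (intro finite_subset[of Q "Pow V"]) auto
  have l: "l \<le> n" "2 \<le> l" "4 \<le> n"
    using V by (auto simp: l_def n_def card_mono)
  have N: "N B = fact n * real (l choose card B) / real (n choose card B)" if "B \<subseteq> V" for B
  proof -
    have "card B \<le> n" using that V(1) by (simp add: n_def card_mono)
    then have "real (n choose card B) \<noteq> 0" by simp
    moreover have "N B * real (n choose card B) = fact n * real (l choose card B)"
      using arg_cong[OF card_permutes_superset[OF V(1,2) that], of real]
      by (simp add: N_def P_def n_def l_def)
    ultimately show ?thesis by (simp add: field_simps)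
  qed
  have sum_ind: "(\<Sum>p\<in>P. if B \<subseteq> p ` L then 1 else 0) = N B" for B
    using finP by (simp add: N_def sum.If_cases Int_def)
  have choose4: "real (j choose 4) = real j * (real j - 1) * ((real j - 2) * (real j - 3)) / 24" for j
    by (simp add: binomial_gbinomial gbinomial_prod_rev fact_numeral numeral_eq_Suc)
  have choose2: "real (j choose 2) = real j * (real j - 1) / 2" for j
    by (simp add: binomial_gbinomial gbinomial_prod_rev fact_numeral numeral_eq_Suc)
  have r0: "0 \<le> r" by (simp add: r_def)
  have N2: "N q = fact n * r" if "q \<in> Q" for q
    using N[of q] Q(2)[OF that] by (simp add: r_def)
  \<comment> \<open>Negative correlation of two disjoint pairs. The left side is the product of
    \<open>(a - i) / (b - i)\<close> for \<open>i\<close> from 0 to 3, and \<open>r\<close> is the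
    product of the first two factors; since \<open>a \<le> b\<close>, the factors decrease in
    \<open>i\<close>. For \<open>l < 4\<close> the left side is 0.\<close>
  have neg: "real (l choose 4) / real (n choose 4) \<le> r\<^sup>2"
  proof (cases "l \<ge> 4")
    case False
    then have "real (l choose 4) = 0" by simp
    then show ?thesis by (simp only: div_0 zero_le_power2)
  next
    case True
    define a b where "a = real l" and "b = real n"
    have ab: "4 \<le> a" "a \<le> b" using True l by (auto simp: a_def b_def)
    have frac_mono: "x / y \<le> u / w" if "0 < y" "0 < w" "x * w \<le> u * y" for x y u w :: real
      using that by (simp add: pos_divide_le_eq pos_le_divide_eq)
    have "(a - 2) / (b - 2) \<le> a / b"
      using ab by (intro frac_mono) (auto simp: algebra_simps)
    moreover have "(a - 3) / (b - 3) \<le> (a - 1) / (b - 1)"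
      using ab by (intro frac_mono) (auto simp: algebra_simps)
    ultimately have "(a - 2) / (b - 2) * ((a - 3) / (b - 3)) \<le> a / b * ((a - 1) / (b - 1))"
      using ab by (intro mult_mono) auto
    then have "a / b * ((a - 1) / (b - 1)) * ((a - 2) / (b - 2) * ((a - 3) / (b - 3)))
      \<le> a / b * ((a - 1) / (b - 1)) * (a / b * ((a - 1) / (b - 1)))"
      using ab by (intro mult_left_mono) auto
    then show ?thesis
      unfolding r_def choose4 choose2 a_def[symmetric] b_def[symmetric]
      by (simp add: power2_eq_square)
  qed
  have N4: "N (q \<union> q') \<le> fact n * r\<^sup>2" if "q \<in> Q" "q' \<in> Q" "q \<noteq> q'" for q q'
  proof -
    have "q \<inter> q' = {}" using Q(1) that by (auto simp: disjoint_def)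
    moreover have "finite q" "finite q'"
      using Q(2)[OF that(1)] Q(2)[OF that(2)] by (auto intro: card_ge_0_finite)
    ultimately have c: "card (q \<union> q') = 4"
      using Q(2)[OF that(1)] Q(2)[OF that(2)] by (simp add: card_Un_disjoint)
    have "N (q \<union> q') = fact n * (real (l choose 4) / real (n choose 4))"
      using N[of "q \<union> q'"] Q(2) that c by simp
    also have "\<dots> \<le> fact n * r\<^sup>2" using neg by (intro mult_left_mono) auto
    finally show ?thesis .
  qed
  have EX: "(\<Sum>p\<in>P. X p) = fact n * (m * r)"
    unfolding X_def by (subst sum.swap) (simp add: sum_ind N2 m_def)
  have EX2: "(\<Sum>p\<in>P. (X p)\<^sup>2) \<le> fact n * (m * r + m\<^sup>2 * r\<^sup>2)"
  proof -
    have "(X p)\<^sup>2 = (\<Sum>q\<in>Q. \<Sum>q'\<in>Q. if q \<union> q' \<subseteq> p ` L then 1 else 0)" for p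
      unfolding X_def power2_eq_square sum_product by (intro sum.cong refl) auto
    then have "(\<Sum>p\<in>P. (X p)\<^sup>2) = (\<Sum>q\<in>Q. \<Sum>p\<in>P. \<Sum>q'\<in>Q. if q \<union> q' \<subseteq> p ` L then 1 else 0)"
      by (simp add: sum.swap[of _ Q P])
    also have "\<dots> = (\<Sum>q\<in>Q. \<Sum>q'\<in>Q. N (q \<union> q'))"
      by (subst sum.swap[of _ Q P]) (simp only: sum_ind)
    \<comment> \<open>The summand \<open>fact n * r\<^sup>2\<close> is granted to the diagonal terms
      as well; it is nonnegative and makes the double sum a closed form.\<close>
    also have "\<dots> \<le> (\<Sum>q\<in>Q. \<Sum>q'\<in>Q. fact n * r\<^sup>2 + (if q' = q then fact n * r else 0))"
    proof (intro sum_mono)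
      fix q q' assume "q \<in> Q" "q' \<in> Q"
      then show "N (q \<union> q') \<le> fact n * r\<^sup>2 + (if q' = q then fact n * r else 0)"
        using N4[of q q'] N2[of q] by (cases "q' = q") auto
    qed
    also have "\<dots> = fact n * (m * r + m\<^sup>2 * r\<^sup>2)"
      using finQ by (simp add: sum.distrib m_def algebra_simps power2_eq_square)
    finally show ?thesis .
  qed
  define Z where "Z = {p \<in> P. \<forall>q\<in>Q. \<not> q \<subseteq> p ` L}"
  \<comment> \<open>On \<open>Z\<close> the count \<open>X\<close> is 0, so each element of
    \<open>Z\<close> contributes the full square of the mean to the total squared deviation.\<close>
  have "real (card Z) * (m * r)\<^sup>2 = (\<Sum>p\<in>Z. (X p - m * r)\<^sup>2)"
    by (simp add: Z_def X_def)
  also have "\<dots> \<le> (\<Sum>p\<in>P. (X p - m * r)\<^sup>2)"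
    using finP by (intro sum_mono2) (auto simp: Z_def)
  also have "\<dots> = (\<Sum>p\<in>P. (X p)\<^sup>2) - 2 * (m * r) * (\<Sum>p\<in>P. X p) + fact n * (m * r)\<^sup>2"
    by (simp add: power2_diff sum.distrib sum_subtractf sum_distrib_left sum_distrib_right
        cP[symmetric] mult_ac)
  also have "\<dots> \<le> fact n * (m * r)"
    using EX2 unfolding EX by (simp add: algebra_simps power2_eq_square)
  finally have Z: "real (card Z) * (m * r) * (m * r) \<le> fact n * (m * r)"
    by (simp add: power2_eq_square mult_ac)
  have Z': "real (card Z) * (m * r) \<le> fact n"
  proof (cases "m * r = 0")
    case False
    moreover have "0 \<le> m * r" using r0 by (simp add: m_def)
    ultimately have "0 < m * r" by linarith
    then show ?thesis using Z by (simp only: mult_le_cancel_right_pos)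
  qed auto
  have c0: "real (n choose 2) > 0" using l by simp
  have "Z = {p. p permutes V \<and> (\<forall>q\<in>Q. \<not> q \<subseteq> p ` L)}" by (auto simp: Z_def P_def)
  with Z' c0 show ?thesis
    by (simp add: r_def m_def n_def l_def divide_simps mult_ac)
qed

section \<open>Disjoint pairs met by every orientation\<close>

text \<open>The pairs are the edges and the pairs with a common neighbour: an orientation that
  chooses neither end of such a pair would choose the common neighbour twice. In a maximal
  disjoint family, distinct uncovered non-isolated vertices have distinct covered neighbours.\<close>

lemma disjoint_pairs_meeting_orientations:
  assumes V: "finite V" and R: "\<And>e. e \<in> R \<Longrightarrow> e \<subseteq> V \<and> card e = 2"
    and g: "inj_on g R" "\<And>e. e \<in> R \<Longrightarrow> g e \<in> e"
  obtains Q where "disjoint Q" "\<And>q. q \<in> Q \<Longrightarrow> q \<subseteq> V \<and> card q = 2" "card R \<le> 4 * card Q"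
    "\<And>\<phi> q. inj_on \<phi> R \<Longrightarrow> \<forall>e\<in>R. \<phi> e \<in> e \<Longrightarrow> q \<in> Q \<Longrightarrow> \<phi> ` R \<inter> q \<noteq> {}"
proof -
  define good where "good x y \<longleftrightarrow> x \<noteq> y \<and> x \<in> V \<and> y \<in> V \<and>
    ({x, y} \<in> R \<or> (\<exists>z. {x, z} \<in> R \<and> {y, z} \<in> R))" for x y
  define F where "F = {Q. disjoint Q \<and> (\<forall>q\<in>Q. \<exists>x y. q = {x, y} \<and> good x y)}"
  have "F \<subseteq> Pow (Pow V)" unfolding F_def good_def by fast
  then have finF: "finite F" using V by (meson finite_Pow_iff finite_subset)
  have "{} \<in> F" by (simp add: F_def disjoint_def)
  then obtain Q where Q: "Q \<in> F" and Qmax: "\<And>Q'. Q' \<in> F \<Longrightarrow> Q \<subseteq> Q' \<Longrightarrow> Q' = Q"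
    using finite_has_maximal[OF finF] by (metis empty_iff)
  have pair: "\<exists>x y. q = {x, y} \<and> good x y" if "q \<in> Q" for q using Q that by (auto simp: F_def)
  have disj: "disjoint Q" using Q by (simp add: F_def)
  have q2: "q \<subseteq> V \<and> card q = 2" if "q \<in> Q" for q
    using pair[OF that] by (auto simp: good_def)
  have finQ: "finite Q" using V q2 by (intro finite_subset[of Q "Pow V"]) auto
  have finq: "finite q" if "q \<in> Q" for q using q2[OF that] V finite_subset by blast
  have cQ: "card (\<Union>Q) = 2 * card Q"
    using card_Union_disjoint[OF disj finq] q2 by simp
  define W where "W = \<Union>R"
  have finW: "finite W" using R V by (intro finite_subset[of W V]) (auto simp: W_def)
  \<comment> \<open>The orientation \<open>g\<close> enters here: its existence forces at least as
    many non-isolated vertices as edges, so a bound on \<open>card W\<close> suffices. A dense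
    \<open>R\<close> would have too few vertices.\<close>
  have "g ` R \<subseteq> W" using g(2) by (auto simp: W_def)
  then have cR: "card R \<le> card W" using card_inj_on_le[OF g(1) _ finW] by blast
  have maxi: False if "good x y" "x \<notin> \<Union>Q" "y \<notin> \<Union>Q" for x y
  proof -
    have "disjoint (insert {x, y} Q)"
      using disj that(2,3) by (auto simp: disjoint_def)
    then have "insert {x, y} Q \<in> F" using pair that(1) by (auto simp: F_def)
    then have "insert {x, y} Q = Q" by (rule Qmax) auto
    then have "{x, y} \<in> Q" by blast
    then show False using that(2) by blast
  qed
  have "\<exists>y. x \<noteq> y \<and> {x, y} \<in> R" if x: "x \<in> W" for x
  proof -
    obtain e where e: "e \<in> R" "x \<in> e" using x by (auto simp: W_def)
    moreover obtain a b where "e = {a, b}" "a \<noteq> b" using R[OF e(1)] by (auto simp: card_2_iff)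
    ultimately show ?thesis by (metis insertE insert_commute singletonD)
  qed
  then obtain nb where nb: "\<And>x. x \<in> W \<Longrightarrow> x \<noteq> nb x \<and> {x, nb x} \<in> R" by metis
  have WV: "W \<subseteq> V" using R by (auto simp: W_def)
  have nbV: "nb x \<in> V" if "x \<in> W" for x using nb[OF that] R by blast
  let ?U = "W - \<Union>Q"
  have "nb ` ?U \<subseteq> \<Union>Q"
  proof
    fix y assume "y \<in> nb ` ?U"
    then obtain x where x: "x \<in> W" "x \<notin> \<Union>Q" "y = nb x" by auto
    then have "good x y" using nb[OF x(1)] nbV WV by (auto simp: good_def)
    then show "y \<in> \<Union>Q" using maxi x(2) by blast
  qed
  moreover have "inj_on nb ?U"
  proof (rule inj_onI, rule ccontr)
    fix x y assume xy: "x \<in> ?U" "y \<in> ?U" "nb x = nb y" "x \<noteq> y"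
    then have "{x, nb x} \<in> R" "{y, nb x} \<in> R" using nb by (metis DiffD1)+
    then have "good x y" using xy WV by (auto simp: good_def)
    then show False using maxi xy by blast
  qed
  moreover have finUQ: "finite (\<Union>Q)" using finQ finq by blast
  ultimately have "card ?U \<le> card (\<Union>Q)" using card_inj_on_le by blast
  moreover have "card W \<le> card ?U + card (\<Union>Q)"
  proof -
    have "card W \<le> card (?U \<union> \<Union>Q)" using finW finUQ by (intro card_mono) auto
    also have "\<dots> \<le> card ?U + card (\<Union>Q)" by (rule card_Un_le)
    finally show ?thesis .
  qed
  \<comment> \<open>The uncovered part of \<open>W\<close> is no larger than the union of
    \<open>Q\<close>, which has \<open>2 * card Q\<close> elements; covered and uncovered vertices
    together give the factor 4.\<close>
  ultimately have bound: "card R \<le> 4 * card Q" using cR cQ by linarith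
  have meet: "\<phi> ` R \<inter> q \<noteq> {}"
    if \<phi>: "inj_on \<phi> R" "\<forall>e\<in>R. \<phi> e \<in> e" and q: "q \<in> Q" for \<phi> q
  proof
    assume none: "\<phi> ` R \<inter> q = {}"
    obtain x y where xy: "q = {x, y}" "good x y" using pair[OF q] by blast
    have x: "x \<notin> \<phi> ` R" and y: "y \<notin> \<phi> ` R" using none xy(1) by auto
    have "{x, y} \<notin> R"
    proof
      assume e: "{x, y} \<in> R"
      show False using bspec[OF \<phi>(2) e] imageI[OF e, of \<phi>] x y by auto
    qed
    then obtain z where z: "{x, z} \<in> R" "{y, z} \<in> R" using xy by (auto simp: good_def)
    have "\<phi> {x, z} = z" "\<phi> {y, z} = z"
      using bspec[OF \<phi>(2) z(1)] bspec[OF \<phi>(2) z(2)]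
        imageI[OF z(1), of \<phi>] imageI[OF z(2), of \<phi>] x y
      by auto
    then have "{x, z} = {y, z}" using \<phi>(1) z by (metis inj_onD)
    then show False using xy(2) by (auto simp: good_def doubleton_eq_iff)
  qed
  show thesis by (rule that[OF disj q2 bound meet])
qed

section \<open>Edge counts and the rounds of the process\<close>

lemma regular_graph_on_card:
  assumes "finite V" "regular_graph_on V d E"
  shows "d * card V = 2 * card E"
proof -
  have E: "\<And>e. e \<in> E \<Longrightarrow> e \<subseteq> V \<and> card e = 2" and d: "\<And>v. v \<in> V \<Longrightarrow> card {e \<in> E. v \<in> e} = d"
    using assms(2) by (auto simp: regular_graph_on_def)
  have finE: "finite E" using E assms(1) by (intro finite_subset[of E "Pow V"]) auto
  have "card {v \<in> V. v \<in> e} = 2" if "e \<in> E" for e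
  proof -
    have "{v \<in> V. v \<in> e} = e" using E[OF that] by auto
    then show ?thesis using E[OF that] by simp
  qed
  then show ?thesis
    using sum_multicount_gen[of V E "\<lambda>v e. v \<in> e" "\<lambda>_. 2"] assms(1) finE d
    by (simp add: mult.commute)
qed

lemma history_append_prefix:
  "m \<le> l \<Longrightarrow> history S v l = history S v m @ map (\<lambda>i. (S (history S v (i - 1)) (v i), v i)) [m + 1..<l + 1]"
proof (induction l)
  case (Suc l)
  then show ?case by (cases "m = Suc l") auto
qed simp

lemma builder_multigraph_edges:
  assumes "m \<le> l"
  shows "set_mset (builder_multigraph S v l) = set_mset (builder_multigraph S v m) \<union>
    (\<lambda>i. {S (history S v (i - 1)) (v i), v i}) ` {m<..l}"
proof -
  have "set [m + 1..<l + 1] = {m<..l}" by auto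
  then show ?thesis
    by (simp add: builder_multigraph_def history_append_prefix[OF assms] image_image del: set_upt)
qed

lemma length_history [simp]: "length (history S v m) = m"
  by (induction m) auto

text \<open>The position \<open>i\<close> runs from 1 to \<open>n\<close>, not from 0 to
  \<open>n - 1\<close>, so the quotient lies in the half-open interval from \<open>j\<close>
  (excluded) to \<open>j + 1\<close> (included) and its ceiling is \<open>j + 1\<close> also when
  \<open>i = n\<close>.\<close>

lemma offered_eq:
  assumes "n \<ge> 1" "i \<in> {1..n}"
  shows "offered n \<pi> (j * n + i) = \<pi> (Suc j) i"
proof -
  have "\<lceil>real (j * n + i) / real n\<rceil> = int j + 1"
    using assms by (intro ceiling_unique) (auto simp: field_simps)
  moreover have "(j * n + i - 1) div n = j"
    using assms by (intro div_nat_eqI) (auto simp: algebra_simps)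
  ultimately show ?thesis by (simp add: offered_def nat_add_distrib)
qed

text \<open>This is the source of independence: everything built in the first \<open>k * n\<close>
  rounds is a function of the first \<open>k\<close> permutations.\<close>

lemma offered_cong:
  assumes "n \<ge> 1" "i \<in> {1..k * n}" "\<And>j. j \<in> {1..k} \<Longrightarrow> \<pi> j = \<rho> j"
  shows "offered n \<pi> i = offered n \<rho> i"
proof -
  define j where "j = (i - 1) div n"
  define r where "r = (i - 1) mod n + 1"
  have i: "i = j * n + r" using assms(2) div_mult_mod_eq[of "i - 1" n] by (simp add: j_def r_def)
  have r: "r \<in> {1..n}" using assms(1) by (simp add: r_def Suc_leI)
  have "j < k" unfolding j_def using assms by (intro less_mult_imp_div_less) auto
  then show ?thesis unfolding i using offered_eq[OF assms(1) r] assms(3)[of "Suc j"] by simp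
qed

text \<open>Each missing edge is sent to the vertex offered in some later round that built it.
  Within one permutation equal offered vertices mean equal rounds, and a round builds one edge, so
  this map is injective. Stopping \<open>g\<close> rounds early confines its values to the first
  \<open>n - g\<close> positions.\<close>

lemma success_imp_orientation:
  assumes n: "n \<ge> 1" and g: "g \<le> n" and p: "inj_on (\<pi> (Suc k)) {1..n}"
    and succ: "tau E n S \<pi> \<le> enat ((k + 1) * n - g)"
  defines "R \<equiv> E - set_mset (builder_multigraph S (offered n \<pi>) (k * n))"
  shows "\<exists>\<phi>. inj_on \<phi> R \<and> (\<forall>e\<in>R. \<phi> e \<in> e) \<and> \<phi> ` R \<subseteq> \<pi> (Suc k) ` {1..n - g}"
proof -
  define m where "m = k * n + (n - g)"
  let ?v = "offered n \<pi>"
  define ed where "ed i = {S (history S ?v (i - 1)) (?v i), ?v i}" for i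
  have "(k + 1) * n - g = m" using g by (simp add: m_def)
  then obtain m' where "m' \<le> m" "E \<subseteq> set_mset (builder_multigraph S ?v m')"
    using succ tau_le_iff by auto
  then have "E \<subseteq> set_mset (builder_multigraph S ?v m)"
    using builder_multigraph_edges[of m' m S ?v] by blast
  then have "R \<subseteq> ed ` {k * n<..m}"
    using builder_multigraph_edges[of "k * n" m S ?v] unfolding R_def ed_def m_def by auto
  then have "\<forall>e\<in>R. \<exists>i. i \<in> {k * n<..m} \<and> e = ed i" by blast
  then obtain c where c: "\<And>e. e \<in> R \<Longrightarrow> c e \<in> {k * n<..m}" "\<And>e. e \<in> R \<Longrightarrow> e = ed (c e)"
    by metis
  have off: "?v i = \<pi> (Suc k) (i - k * n) \<and> i - k * n \<in> {1..n - g}" if "i \<in> {k * n<..m}" for i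
  proof -
    have "i - k * n \<in> {1..n - g}" using that by (auto simp: m_def)
    moreover from this have "i - k * n \<in> {1..n}" by auto
    ultimately show ?thesis using offered_eq[OF n, of "i - k * n" \<pi> k] that by simp
  qed
  have "inj_on (\<lambda>e. ?v (c e)) R"
  proof (rule inj_onI)
    fix e e' assume e: "e \<in> R" "e' \<in> R" "?v (c e) = ?v (c e')"
    have "c e - k * n \<in> {1..n}" "c e' - k * n \<in> {1..n}"
      using off[OF c(1)[OF e(1)]] off[OF c(1)[OF e(2)]] by auto
    moreover have "\<pi> (Suc k) (c e - k * n) = \<pi> (Suc k) (c e' - k * n)"
      using off[OF c(1)[OF e(1)]] off[OF c(1)[OF e(2)]] e(3) by simp
    ultimately have "c e - k * n = c e' - k * n" using p by (meson inj_onD)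
    moreover have "k * n < c e" "k * n < c e'" using c(1)[OF e(1)] c(1)[OF e(2)] by auto
    ultimately have "c e = c e'" by linarith
    then show "e = e'" using c(2) e by metis
  qed
  moreover have "?v (c e) \<in> e" if "e \<in> R" for e
    using c(2)[OF that] by (metis ed_def insertI1 insert_commute)
  moreover have "(\<lambda>e. ?v (c e)) ` R \<subseteq> \<pi> (Suc k) ` {1..n - g}"
    using off c(1) by auto
  ultimately show ?thesis by blast
qed

section \<open>Probability bound for a fixed strategy\<close>

text \<open>Conditioning on the first \<open>k\<close> permutations, written as a finite union
  bound: each of the \<open>fact n ^ k\<close> possible values \<open>h\<close> has a cylinder of
  probability at most \<open>c / fact n ^ k\<close>, since the next permutation is uniform and
  independent of \<open>h\<close>.\<close>

lemma measure_perm_space_le: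
  assumes E: "\<And>h. h \<in> {1..k} \<rightarrow>\<^sub>E {p. p permutes {1..n}} \<Longrightarrow> B h \<subseteq> {p. p permutes {1..n}} \<and>
      real (card (B h)) \<le> c * fact n"
    and A: "\<And>\<pi>. \<pi> \<in> A \<Longrightarrow> \<pi> \<in> space (perm_space n) \<and> \<pi> (Suc k) \<in> B (restrict \<pi> {1..k})"
  shows "measure (perm_space n) A \<le> c"
proof -
  define P where "P = {p. p permutes {1..n}}"
  let ?U = "uniform_count_measure P"
  define H where "H = ({1..k} \<rightarrow>\<^sub>E P)"
  define J where "J = {1..Suc k}"
  \<comment> \<open>The box \<open>X h\<close> fixes coordinates 1 to \<open>k\<close> to the values
    of \<open>h\<close> and confines coordinate \<open>Suc k\<close> to \<open>B h\<close>;
    \<open>C h\<close> is the cylinder above this box.\<close>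
  define X where "X h i = (if i = Suc k then B h else {h i})" for h i
  define C where "C h = prod_emb {1..} (\<lambda>_. ?U) J (Pi\<^sub>E J (X h))" for h
  have finP: "finite P" and cP: "card P = fact n"
    by (auto simp: P_def finite_permutations card_permutations)
  have "id \<in> P" by (simp add: P_def permutes_id)
  then have neP: "P \<noteq> {}" by blast
  have pU: "prob_space ?U" using finP neP by (rule prob_space_uniform_count_measure)
  interpret product_prob_space "\<lambda>_. ?U" "{1..}"
    by (intro product_prob_spaceI pU)
  interpret PS: prob_space "perm_space n" by (rule prob_space_perm_space)
  have ps: "perm_space n = PiM {1..} (\<lambda>_. ?U)" by (simp add: perm_space_def P_def)
  have finH: "finite H" and cH: "card H = fact n ^ k"
    using finP by (auto simp: H_def finite_PiE card_PiE cP)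
  have B: "B h \<subseteq> P" "real (card (B h)) \<le> c * fact n" if "h \<in> H" for h
    using E that by (auto simp: P_def H_def)
  have X: "X h i \<in> sets ?U" if "h \<in> H" "i \<in> J" for h i
    using B(1)[OF that(1)] that by (auto simp: X_def H_def J_def sets_uniform_count_measure PiE_def Pi_def le_Suc_eq)
  have J: "J \<subseteq> {1..}" "finite J" by (auto simp: J_def)
  have C_sets: "C h \<in> sets (perm_space n)" if "h \<in> H" for h
    unfolding ps C_def using J X[OF that] by (intro sets_PiM_I) auto
  have mC: "measure (perm_space n) (C h) \<le> c / fact n ^ k" if h: "h \<in> H" for h
  proof -
    have "measure (perm_space n) (C h) = (\<Prod>i\<in>J. measure ?U (X h i))"
      unfolding ps C_def using J X[OF h] by (intro measure_PiM_emb) auto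
    also have "J = insert (Suc k) {1..k}" by (auto simp: J_def)
    also have "(\<Prod>i\<in>\<dots>. measure ?U (X h i)) = measure ?U (B h) * (\<Prod>i\<in>{1..k}. measure ?U {h i})"
      by (simp add: X_def)
    also have "(\<Prod>i\<in>{1..k}. measure ?U {h i}) = (\<Prod>i\<in>{1..k}. 1 / fact n)"
    proof (intro prod.cong refl)
      fix i assume "i \<in> {1..k}"
      then have "h i \<in> P" using h unfolding H_def by (rule PiE_mem[rotated])
      then show "measure ?U {h i} = 1 / fact n"
        using finP by (simp add: measure_uniform_count_measure cP)
    qed
    also have "measure ?U (B h) = real (card (B h)) / fact n"
      using B(1)[OF h] finP by (simp add: measure_uniform_count_measure cP)
    also have "real (card (B h)) / fact n * (\<Prod>i\<in>{1..k}. 1 / fact n) \<le> c * (1 / fact n ^ k)"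
      using B(2)[OF h] by (auto simp: power_one_over divide_simps)
    finally show ?thesis by simp
  qed
  have "A \<subseteq> (\<Union>h\<in>H. C h)"
  proof
    fix \<pi> assume "\<pi> \<in> A"
    with A have sp: "\<pi> \<in> space (perm_space n)" and last: "\<pi> (Suc k) \<in> B (restrict \<pi> {1..k})"
      by auto
    have "restrict \<pi> {1..k} \<in> H"
      using sp by (auto simp: ps space_PiM space_uniform_count_measure H_def)
    moreover have "\<pi> \<in> C (restrict \<pi> {1..k})"
      using sp last by (auto simp: ps C_def prod_emb_def X_def J_def space_PiM le_Suc_eq)
    ultimately show "\<pi> \<in> (\<Union>h\<in>H. C h)" by blast
  qed
  moreover have "(\<Union>h\<in>H. C h) \<in> sets (perm_space n)" using finH C_sets by auto
  ultimately have "measure (perm_space n) A \<le> measure (perm_space n) (\<Union>h\<in>H. C h)"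
    by (rule PS.finite_measure_mono)
  also have "\<dots> \<le> (\<Sum>h\<in>H. measure (perm_space n) (C h))"
    using finH C_sets by (intro PS.finite_measure_subadditive_finite) auto
  also have "\<dots> \<le> (\<Sum>h\<in>H. c / fact n ^ k)" using mC by (rule sum_mono)
  also have "\<dots> = c" using cH by simp
  finally show ?thesis .
qed

lemma success_prob_le:
  assumes n: "4 \<le> n" and g: "2 \<le> g" "g \<le> n"
    and E: "regular_graph_on {1..n} (2 * k + 1) E"
  shows "success_prob E n ((k + 1) * n - g) S \<le> 16 * real n / (real g)\<^sup>2"
proof -
  define R where "R h = E - set_mset (builder_multigraph S (offered n h) (k * n))" for h
  define B where "B h = {p. p permutes {1..n} \<and> (\<exists>\<phi>. inj_on \<phi> (R h) \<and> (\<forall>e\<in>R h. \<phi> e \<in> e) \<and>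
    \<phi> ` R h \<subseteq> p ` {1..n - g})}" for h
  have E2: "e \<subseteq> {1..n} \<and> card e = 2" if "e \<in> E" for e
    using E that by (auto simp: regular_graph_on_def)
  \<comment> \<open>In \<open>k * n\<close> rounds at most \<open>k * n\<close> distinct edges are
    built, while the graph has \<open>(2 * k + 1) * n / 2\<close> of them, so at least
    \<open>n / 2\<close> are missing whatever the strategy.\<close>
  have cardR: "n \<le> 2 * card (R h)" for h
  proof -
    have "card (set_mset (builder_multigraph S (offered n h) (k * n))) \<le> k * n"
      using card_length[of "map (\<lambda>(u, w). {u, w}) (history S (offered n h) (k * n))"]
      by (simp add: builder_multigraph_def)
    then have "card E - k * n \<le> card (R h)"
      using diff_card_le_card_Diff[of "set_mset (builder_multigraph S (offered n h) (k * n))" E]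
      unfolding R_def by simp
    moreover have "(2 * k + 1) * n = 2 * card E"
      using regular_graph_on_card[OF _ E] by simp
    ultimately show ?thesis by (simp add: algebra_simps)
  qed
  have cardB: "real (card (B h)) \<le> 16 * real n / (real g)\<^sup>2 * fact n" for h
  \<comment> \<open>An element of \<open>B h\<close> supplies the orientation from which the
    disjoint pairs are constructed; with no such element the bound is trivial.\<close>
  proof (cases "B h = {}")
    case False
    then obtain \<phi>0 where \<phi>0: "inj_on \<phi>0 (R h)" "\<forall>e\<in>R h. \<phi>0 e \<in> e"
      unfolding B_def by auto
    have R2: "e \<subseteq> {1..n} \<and> card e = 2" if "e \<in> R h" for e
      using E2 that by (simp add: R_def)
    obtain Q where Q: "disjoint Q" "\<And>q. q \<in> Q \<Longrightarrow> q \<subseteq> {1..n} \<and> card q = 2"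
      "card (R h) \<le> 4 * card Q"
      and meet: "\<And>\<phi> q. inj_on \<phi> (R h) \<Longrightarrow> \<forall>e\<in>R h. \<phi> e \<in> e \<Longrightarrow> q \<in> Q \<Longrightarrow> \<phi> ` R h \<inter> q \<noteq> {}"
      using disjoint_pairs_meeting_orientations[OF finite_atLeastAtMost R2 \<phi>0(1) bspec[OF \<phi>0(2)]]
      by metis
    \<comment> \<open>The positions of the last \<open>g\<close> rounds: the image of
      \<open>L\<close> under the last permutation is the set of vertices not yet offered when
      Builder stops.\<close>
    define L where "L = {n - g<..n}"
    define Z where "Z = {p. p permutes {1..n} \<and> (\<forall>q\<in>Q. \<not> q \<subseteq> p ` L)}"
    have L: "L \<subseteq> {1..n}" "card L = g" using g by (auto simp: L_def)
    have "B h \<subseteq> Z"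
    proof
      fix p assume "p \<in> B h"
      then obtain \<phi> where p: "p permutes {1..n}" and \<phi>: "inj_on \<phi> (R h)" "\<forall>e\<in>R h. \<phi> e \<in> e"
        and im: "\<phi> ` R h \<subseteq> p ` {1..n - g}"
        unfolding B_def by blast
      have "p ` {1..n - g} \<inter> p ` L = {}"
        using permutes_inj[OF p] by (auto simp: L_def inj_eq)
      then have "\<not> q \<subseteq> p ` L" if "q \<in> Q" for q using meet[OF \<phi> that] im by blast
      then show "p \<in> Z" using p by (simp add: Z_def)
    qed
    moreover have "finite Z"
      unfolding Z_def by (rule finite_subset[OF _ finite_permutations[of "{1..n}"]]) auto
    ultimately have BZ: "real (card (B h)) \<le> real (card Z)" by (simp add: card_mono)
    have ch: "real (j choose 2) = real j * (real j - 1) / 2" for j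
      by (simp add: binomial_gbinomial gbinomial_prod_rev fact_numeral numeral_eq_Suc)
    have "real (card Z) * (real (card Q) * real (g choose 2)) \<le> fact n * real (n choose 2)"
      using card_permutes_avoiding_pairs[of "{1..n}" L Q] L n g Q(1,2) by (simp add: Z_def)
    \<comment> \<open>Here \<open>card Q\<close> is at least a quarter of \<open>n / 2\<close>, and
      \<open>g choose 2\<close> is at least a quarter of \<open>g\<^sup>2\<close> because
      \<open>g \<ge> 2\<close>. Against \<open>n\<^sup>2 / 2\<close> on the other side this gives
      the constant 8 * 4 / 2 = 16.\<close>
    moreover have "real n / 8 * ((real g)\<^sup>2 / 4) \<le> real (card Q) * real (g choose 2)"
    proof (rule mult_mono)
      show "real n / 8 \<le> real (card Q)" using cardR[of h] Q(3) by linarith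
      have "real g * (real g / 2) \<le> real g * (real g - 1)" using g by (intro mult_left_mono) auto
      then show "(real g)\<^sup>2 / 4 \<le> real (g choose 2)" by (simp add: ch power2_eq_square)
    qed auto
    ultimately have "real (card Z) * (real n / 8 * ((real g)\<^sup>2 / 4)) \<le> fact n * real (n choose 2)"
      by (meson mult_left_mono of_nat_0_le_iff order_trans)
    also have "\<dots> \<le> fact n * (real n * real n / 2)"
      by (intro mult_left_mono) (auto simp: ch intro!: mult_left_mono)
    finally have "real n * (real (card Z) * (real g)\<^sup>2) \<le> real n * (16 * real n * fact n)"
      by (simp add: algebra_simps)
    then have "real (card Z) * (real g)\<^sup>2 \<le> 16 * real n * fact n"
      using n by (simp only: mult_le_cancel_left_pos of_nat_0_less_iff)
    then have "real (card Z) \<le> 16 * real n * fact n / (real g)\<^sup>2"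
      using g by (subst pos_le_divide_eq) auto
    with BZ show ?thesis by simp
  qed simp
  show ?thesis
    unfolding success_prob_def
  proof (rule measure_perm_space_le)
    fix \<pi> assume "\<pi> \<in> {\<pi> \<in> space (perm_space n). tau E n S \<pi> \<le> enat ((k + 1) * n - g)}"
    then have sp: "\<pi> \<in> space (perm_space n)" and t: "tau E n S \<pi> \<le> enat ((k + 1) * n - g)"
      by auto
    have p: "\<pi> (Suc k) permutes {1..n}"
      using sp by (auto simp: perm_space_def space_PiM space_uniform_count_measure)
    have "history S (offered n \<pi>) (k * n) = history S (offered n (restrict \<pi> {1..k})) (k * n)"
      using n by (intro history_cong offered_cong) auto
    then have "E - set_mset (builder_multigraph S (offered n \<pi>) (k * n)) = R (restrict \<pi> {1..k})"
      by (simp add: R_def builder_multigraph_def)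
    then show "\<pi> \<in> space (perm_space n) \<and> \<pi> (Suc k) \<in> B (restrict \<pi> {1..k})"
      using success_imp_orientation[OF _ g(2) permutes_inj_on[OF p] t] n sp p by (simp add: B_def)
  qed (use cardB in \<open>auto simp: B_def\<close>)
qed

section \<open>The labelled hitting time and the limit\<close>

text \<open>The bound on the success probability is uniform over strategies, so it passes to the
  maximum that defines the distribution of \<open>T\<close>; the complementary event then gives the
  claim.\<close>

lemma is_tau_lab_prob_ge:
  assumes n: "4 \<le> n" and g: "2 \<le> g" "g \<le> n"
    and E: "regular_graph_on {1..n} (2 * k + 1) E" and T: "is_tau_lab E n M T"
  shows "1 - 16 * real n / (real g)\<^sup>2 \<le> measure M {x \<in> space M.
    ereal ((real k + 1) * real n - real g) \<le> ereal_of_enat (T x)}"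
proof -
  define m where "m = (k + 1) * n - g"
  have prob: "prob_space M" and meas: "T \<in> M \<rightarrow>\<^sub>M count_space UNIV"
    and dist: "measure M {x \<in> space M. T x \<le> enat m} = Max (success_prob E n m ` strategies n)"
    using T by (auto simp: is_tau_lab_def)
  interpret prob_space M by fact
  have ev: "{x \<in> space M. P (T x)} \<in> sets M" for P
    using measurable_sets[OF meas, of "{t. P t}"] by (simp add: vimage_def Int_def conj_commute)
  have "Max (success_prob E n m ` strategies n) \<le> 16 * real n / (real g)\<^sup>2"
    using finite_success_probs[of n E m] strategies_nonempty[of n] success_prob_le[OF n g E] n
    by (subst Max_le_iff) (auto simp: m_def)
  then have "1 - 16 * real n / (real g)\<^sup>2 \<le> 1 - measure M {x \<in> space M. T x \<le> enat m}"
    using dist by simp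
  also have "\<dots> = measure M (space M - {x \<in> space M. T x \<le> enat m})"
    using ev by (simp add: prob_compl)
  also have "\<dots> \<le> measure M {x \<in> space M.
    ereal ((real k + 1) * real n - real g) \<le> ereal_of_enat (T x)}"
  proof (rule finite_measure_mono)
    have "real m = (real k + 1) * real n - real g"
      using g by (simp add: m_def of_nat_diff algebra_simps)
    then have le: "ereal ((real k + 1) * real n - real g) \<le> ereal_of_enat t" if "\<not> t \<le> enat m" for t
      using that by (cases t) auto
    then show "space M - {x \<in> space M. T x \<le> enat m} \<subseteq>
      {x \<in> space M. ereal ((real k + 1) * real n - real g) \<le> ereal_of_enat (T x)}" by blast
  qed (rule ev)
  finally show ?thesis .
qed

text \<open>The filter expresses the limit along even \<open>n\<close>. Comparison in the extended
  reals lets \<open>T\<close> be infinite and keeps the subtraction of \<open>f n\<close>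
  untruncated.\<close>

theorem theorem7p1:
  fixes f k :: "nat \<Rightarrow> nat" and G :: "nat \<Rightarrow> nat set set"
    and M :: "nat \<Rightarrow> 'a measure" and T :: "nat \<Rightarrow> 'a \<Rightarrow> enat"
  assumes "(\<lambda>n. real (f n)) \<in> \<omega>(\<lambda>n. sqrt (real n))"
    and "\<forall>\<^sub>F n in sequentially. even n \<longrightarrow> 1 \<le> k n \<and> real (k n) \<le> real n / 2 - 1"
    and "\<forall>\<^sub>F n in sequentially. even n \<longrightarrow> regular_graph_on {1..n} (2 * k n + 1) (G n)"
    and "\<forall>\<^sub>F n in sequentially. even n \<longrightarrow> is_tau_lab (G n) n (M n) (T n)"
  shows "((\<lambda>n. measure (M n) {x \<in> space (M n).
            ereal ((real (k n) + 1) * real n - real (f n)) \<le> ereal_of_enat (T n x)})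
          \<longlongrightarrow> 1) (inf sequentially (principal {n. even n}))"
proof -
  let ?F = "inf sequentially (principal {n. even n})"
  let ?p = "\<lambda>n. measure (M n) {x \<in> space (M n).
            ereal ((real (k n) + 1) * real n - real (f n)) \<le> ereal_of_enat (T n x)}"
  have f_large: "\<forall>\<^sub>F n in sequentially. c * sqrt (real n) \<le> real (f n)" for c
    using smallomegaD[OF assms(1), of c] by simp
  have "\<forall>\<^sub>F n in sequentially. even n \<longrightarrow> 1 - e \<le> ?p n \<and> ?p n \<le> 1" if e: "e > 0" for e :: real
  proof -
    \<comment> \<open>With this \<open>c\<close>, a value \<open>g \<ge> c * sqrt n\<close> makes
      the error \<open>16 * n / g\<^sup>2\<close> at most \<open>e\<close>.\<close>
    define c where "c = 4 / sqrt e"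
    have c: "c > 0" "c\<^sup>2 = 16 / e" using e by (auto simp: c_def power_divide)
    have "\<forall>\<^sub>F n in sequentially. max 4 (16 / e) \<le> real n"
      using filterlim_real_sequentially by (simp only: filterlim_at_top)
    with f_large[of c] f_large[of 1] assms(3,4) show ?thesis
    proof eventually_elim
      case (elim n)
      show ?case
      proof
        assume "even n"
        then have E: "regular_graph_on {1..n} (2 * k n + 1) (G n)"
          and T: "is_tau_lab (G n) n (M n) (T n)" using elim by auto
        interpret prob_space "M n" using T by (simp add: is_tau_lab_def)
        have meas: "T n \<in> M n \<rightarrow>\<^sub>M count_space UNIV" using T by (simp add: is_tau_lab_def)
        have n: "4 \<le> n" "16 / e \<le> real n" using elim by auto
        \<comment> \<open>The finite bound needs \<open>g \<le> n\<close>, so \<open>f n\<close> is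
          capped, which only shrinks the event. If the cap is active, the error is
          \<open>16 / n\<close>, and \<open>n \<ge> 16 / e\<close> handles it. The instance
          \<open>c = 1\<close> of \<open>f_large\<close> together with \<open>n \<ge> 4\<close>
          ensures \<open>2 \<le> g\<close>.\<close>
        define g where "g = min (f n) n"
        have "2 \<le> sqrt (real n)" using n by (intro real_le_rsqrt) auto
        then have g: "2 \<le> g" "g \<le> n" using elim n by (auto simp: g_def)
        have "16 * real n \<le> e * (real g)\<^sup>2"
        proof (cases "f n \<le> n")
          case True
          have "(c * sqrt (real n))\<^sup>2 \<le> (real (f n))\<^sup>2"
            using elim c by (intro power_mono) auto
          then show ?thesis using True e by (simp add: g_def power_mult_distrib c field_simps)
        next
          case False
          have "16 \<le> e * real n" using n(2) e by (simp add: field_simps)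
          then have "16 * real n \<le> e * real n * real n" by (intro mult_right_mono) auto
          then show ?thesis using False by (simp add: g_def power2_eq_square mult_ac)
        qed
        then have "16 * real n / (real g)\<^sup>2 \<le> e"
          using g by (subst pos_divide_le_eq) auto
        then have "1 - e \<le> 1 - 16 * real n / (real g)\<^sup>2" by simp
        also have "\<dots> \<le> measure (M n) {x \<in> space (M n).
            ereal ((real (k n) + 1) * real n - real g) \<le> ereal_of_enat (T n x)}"
          by (rule is_tau_lab_prob_ge[OF n(1) g E T])
        also have "\<dots> \<le> ?p n"
        proof (rule finite_measure_mono)
          have "ereal ((real (k n) + 1) * real n - real (f n)) \<le>
              ereal ((real (k n) + 1) * real n - real g)"
            by (simp add: g_def)
          then show "{x \<in> space (M n).
              ereal ((real (k n) + 1) * real n - real g) \<le> ereal_of_enat (T n x)} \<subseteq>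
            {x \<in> space (M n).
              ereal ((real (k n) + 1) * real n - real (f n)) \<le> ereal_of_enat (T n x)}"
            using order_trans by blast
          show "{x \<in> space (M n).
              ereal ((real (k n) + 1) * real n - real (f n)) \<le> ereal_of_enat (T n x)} \<in> sets (M n)"
            using measurable_sets[OF meas, of "{t. ereal ((real (k n) + 1) * real n - real (f n))
              \<le> ereal_of_enat t}"]
            by (simp add: vimage_def Int_def conj_commute)
        qed
        finally show "1 - e \<le> ?p n \<and> ?p n \<le> 1" by simp
      qed
    qed
  qed
  then have close: "\<forall>\<^sub>F n in ?F. 1 - e \<le> ?p n \<and> ?p n \<le> 1" if "e > 0" for e
    using that by (simp add: eventually_inf_principal)
  show ?thesis
  proof (rule tendstoI)
    fix e :: real assume "e > 0"
    then have "e / 2 > 0" by simp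
    from close[OF this] show "\<forall>\<^sub>F n in ?F. dist (?p n) 1 < e"
      by (rule eventually_mono) (use \<open>e > 0\<close> in \<open>auto simp: dist_real_def\<close>)
  qed
qed

end
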